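(* Algorithm $\mathcal{A}$ is an $|R|$-approximation algorithm for $mRmD$ instances with the same starting location for every resource.
   Context: Problem $mRmD$ (heterogeneous multi-resource allocation with subset demand requests). An instance consists of: a finite set $D$ of demands; a finite set $R$ of resource types; for each $r\in R$ a finite set $S^r$ of starting locations and, for each $s\in S^r$, a number $l_s^r$ of resources of type $r$ starting at $s$; for each demand $d\in D$ a nonempty set $M_d\subseteq R$ of required resource types, a service start time $\tau_d\ge 0$, a service duration $\Delta_d>0$ and a reward $w_d\ge 0$; and travel times $f_{xy}\ge 0$ between any two locations ($f_{ij}$ is the travel time between the locations of demands $i$ and $j$, and $f_{sd}$ that from starting location $s$ to the location of demand $d$). All these numbers are integers. Demand $d$ requires one unit of every resource type in $M_d$ simultaneously at time $\tau_d$ for duration $\Delta_d$. A resource of type $r$ starting at $s\in S^r$ can serve $d$ as its first demand iff $r\in M_d$ and $f_{sd}\le\tau_d$; a resource of type $r$ can serve $j$ immediately after $i$ iff $r\in M_i\cap M_j$ and $\tau_i+\Delta_i+f_{ij}\le\tau_j$. A feasible solution assigns to each resource a (possibly empty) path, i.e. a sequence of demands whose first element can be served first and in which each consecutive pair can be served one immediately after the other. Demand $d$ is met if, for every $r\in M_d$, at least one resource of type $r$ has $d$ on its path. The objective is to maximize the sum of $w_d$ over met demands $d$. An $\alpha$-approximation algorithm ($\alpha\ge 1$) is an algorithm that, for every instance, returns a feasible solution with objective value at least $\frac1\alpha$ times the optimal objective value, in time polynomial in the size of the instance. Resource types are labeled $1,\dots,|R|$ so that $m_1\le m_2\le\dots\le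 m_{|R|}$, where $m_r$ is the number of resources of type $r$. For a current demand set $D$, let $D^r=\{i\in D: r\in M_i\}$, and let $1R1D^r$ be the single-resource-type problem obtained by keeping only the $m_r$ resources of type $r$ and the demands $D^r$, each regarded as requiring only type $r$; it can be solved to optimality in polynomial time. Algorithm $\mathcal{A}$: start with value $0$ (empty solution). For $r=1,\dots,|R|$ in order: solve $1R1D^r$ optimally for the current demand set $D$; if its optimal value is at least the best value so far, record it as the new best; then replace $D$ by $D\setminus D^r$. Output the best value, together with the corresponding solution, which serves the demands met in the recorded optimal solution of $1R1D^r$, resources of the other types required by these demands following the schedules of the type-$r$ resources in that solution.
   Formalization: The formal theorem also assumes that travel times satisfy the triangle inequality; without it the claim is false, since skipping an intermediate demand can make a path infeasible, so the output may be infeasible or miss the ratio |R|. *)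

theory Defs
  imports Complex_Main "HOL-Library.Log_Nat" "HOL-Library.Monad_Syntax"
begin

text \<open>
  Demands, resource types and locations are named by natural numbers.  The record consists of finite
  index lists and of tables over them; entries of the tables outside the index lists are irrelevant.
  The travel times f_ij and f_sd of the problem description are
  \<open>travel I (dloc I i) (dloc I j)\<close> and \<open>travel I s (dloc I d)\<close>.
\<close>

record mrmd =
  demands :: "nat list"                   \<comment> \<open>the set D\<close>
  rtypes  :: "nat list"                   \<comment> \<open>the set R\<close>
  starts  :: "nat \<Rightarrow> nat list"            \<comment> \<open>\<open>starts r\<close>: the set of starting locations of type r\<close>
  amount  :: "nat \<Rightarrow> nat \<Rightarrow> nat"          \<comment> \<open>\<open>amount r s\<close>: number of resources of type r at s\<close>
  req     :: "nat \<Rightarrow> nat list"            \<comment> \<open>\<open>req d\<close>: the set of resource types required by d\<close>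
  stime   :: "nat \<Rightarrow> nat"
  dur     :: "nat \<Rightarrow> nat"
  reward  :: "nat \<Rightarrow> nat"
  dloc    :: "nat \<Rightarrow> nat"
  travel  :: "nat \<Rightarrow> nat \<Rightarrow> nat"

definition wf_mrmd :: "mrmd \<Rightarrow> bool" where
  "wf_mrmd I \<longleftrightarrow>
     distinct (demands I) \<and> distinct (rtypes I) \<and>
     (\<forall>r\<in>set (rtypes I). distinct (starts I r)) \<and>
     (\<forall>d\<in>set (demands I). distinct (req I d) \<and> req I d \<noteq> [] \<and> set (req I d) \<subseteq> set (rtypes I)
        \<and> dur I d > 0)"

definition locations :: "mrmd \<Rightarrow> nat set" where
  "locations I = dloc I ` set (demands I) \<union> (\<Union>r\<in>set (rtypes I). set (starts I r))"

text \<open>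
  Needed by the algorithm: a resource that follows another one skips the demands that do not require
  its own type, and a path through the remaining demands uses direct travel times.
\<close>

definition triangle_ineq :: "mrmd \<Rightarrow> bool" where
  "triangle_ineq I \<longleftrightarrow>
     (\<forall>x\<in>locations I. \<forall>y\<in>locations I. \<forall>z\<in>locations I. travel I x z \<le> travel I x y + travel I y z)"

text \<open>The resource \<open>(r, s, k)\<close> is the \<open>k\<close>-th resource of type \<open>r\<close> starting at \<open>s\<close>.\<close>

type_synonym resource = "nat \<times> nat \<times> nat"

definition resources :: "mrmd \<Rightarrow> resource set" where
  "resources I = {(r, s, k). r \<in> set (rtypes I) \<and> s \<in> set (starts I r) \<and> k < amount I r s}"

definition same_start :: "mrmd \<Rightarrow> bool" where
  "same_start I \<longleftrightarrow> (\<exists>s0. \<forall>(r, s, k)\<in>resources I. s = s0)"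

definition serves_first :: "mrmd \<Rightarrow> nat \<Rightarrow> nat \<Rightarrow> nat \<Rightarrow> bool" where
  "serves_first I r s d \<longleftrightarrow> r \<in> set (req I d) \<and> travel I s (dloc I d) \<le> stime I d"

definition serves_next :: "mrmd \<Rightarrow> nat \<Rightarrow> nat \<Rightarrow> nat \<Rightarrow> bool" where
  "serves_next I r i j \<longleftrightarrow> r \<in> set (req I i) \<inter> set (req I j) \<and>
     stime I i + dur I i + travel I (dloc I i) (dloc I j) \<le> stime I j"

definition valid_path :: "mrmd \<Rightarrow> resource \<Rightarrow> nat list \<Rightarrow> bool" where
  "valid_path I = (\<lambda>(r, s, k) p. set p \<subseteq> set (demands I) \<and>
     (p \<noteq> [] \<longrightarrow> serves_first I r s (hd p)) \<and> successively (serves_next I r) p)"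

text \<open>
  The amounts are encoded in binary, so a polynomial-size solution cannot mention every resource:
  resources that are not listed have the empty path.
\<close>

type_synonym solution = "(resource \<times> nat list) list"

definition feasible :: "mrmd \<Rightarrow> solution \<Rightarrow> bool" where
  "feasible I S \<longleftrightarrow> distinct (map fst S) \<and> (\<forall>(x, p)\<in>set S. x \<in> resources I \<and> valid_path I x p)"

definition met :: "mrmd \<Rightarrow> solution \<Rightarrow> nat \<Rightarrow> bool" where
  "met I S d \<longleftrightarrow> (\<forall>r\<in>set (req I d). \<exists>s k p. ((r, s, k), p) \<in> set S \<and> d \<in> set p)"

definition objective :: "mrmd \<Rightarrow> solution \<Rightarrow> nat" where
  "objective I S = (\<Sum>d\<in>{d \<in> set (demands I). met I S d}. reward I d)"

definition opt :: "mrmd \<Rightarrow> nat" where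
  "opt I = Max {objective I S | S. feasible I S}"

lemma opt_attained: "\<exists>S. feasible I S \<and> objective I S = opt I"
  and objective_le_opt: "feasible I S \<Longrightarrow> objective I S \<le> opt I"
proof -
  have "{objective I S | S. feasible I S} \<subseteq> {..\<Sum>d\<in>set (demands I). reward I d}"
    by (auto simp: objective_def intro!: sum_mono2)
  then have fin: "finite {objective I S | S. feasible I S}"
    by (rule finite_subset) simp
  have "feasible I []"
    by (simp add: feasible_def)
  then have ne: "{objective I S | S. feasible I S} \<noteq> {}"
    by blast
  show "\<exists>S. feasible I S \<and> objective I S = opt I"
    using Max_in[OF fin ne] unfolding opt_def by auto
  show "objective I S \<le> opt I" if "feasible I S"
    unfolding opt_def using fin that by (intro Max_ge) auto
qed

text \<open>Binary length of a number, plus one bit for a separator.\<close>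

definition nbits :: "nat \<Rightarrow> nat" where
  "nbits n = Suc (floorlog 2 n)"

definition inst_size :: "mrmd \<Rightarrow> nat" where
  "inst_size I = Suc (
     (\<Sum>d\<in>set (demands I). nbits d + (\<Sum>r\<in>set (req I d). nbits r) + nbits (stime I d)
         + nbits (dur I d) + nbits (reward I d) + nbits (dloc I d)) +
     (\<Sum>r\<in>set (rtypes I). nbits r + (\<Sum>s\<in>set (starts I r). nbits s + nbits (amount I r s))) +
     (\<Sum>x\<in>locations I. \<Sum>y\<in>locations I. nbits (travel I x y)))"

definition sol_size :: "solution \<Rightarrow> nat" where
  "sol_size S = (\<Sum>((r, s, k), p)\<leftarrow>S. nbits r + nbits s + nbits k + (\<Sum>d\<leftarrow>p. nbits d))"

text \<open>
  A computation is a value together with the number of bit operations spent on it.  In the programs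
  below every function call costs one step, comparing, adding or writing numbers costs their binary
  length, and each access to a table of the instance, as well as the construction of a subinstance,
  costs a scan of the whole instance.
\<close>

datatype 'a tm = TM (result: 'a) (time: nat)

definition bind_tm :: "'a tm \<Rightarrow> ('a \<Rightarrow> 'b tm) \<Rightarrow> 'b tm" where
  "bind_tm m f = TM (result (f (result m))) (time m + time (f (result m)))"

adhoc_overloading Monad_Syntax.bind \<rightleftharpoons> bind_tm

definition charge :: "nat \<Rightarrow> 'a \<Rightarrow> 'a tm" where
  "charge c x = TM x c"

abbreviation return_tm :: "'a \<Rightarrow> 'a tm" where
  "return_tm \<equiv> charge 1"

definition eq_tm :: "nat \<Rightarrow> nat \<Rightarrow> bool tm" where
  "eq_tm m n = charge (nbits m + nbits n) (m = n)"

definition le_tm :: "nat \<Rightarrow> nat \<Rightarrow> bool tm" where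
  "le_tm m n = charge (nbits m + nbits n) (m \<le> n)"

definition add_tm :: "nat \<Rightarrow> nat \<Rightarrow> nat tm" where
  "add_tm m n = charge (nbits m + nbits n) (m + n)"

definition lookup_tm :: "mrmd \<Rightarrow> 'a \<Rightarrow> 'a tm" where
  "lookup_tm I x = charge (inst_size I) x"

definition poly_time_on :: "(mrmd \<Rightarrow> bool) \<Rightarrow> (mrmd \<Rightarrow> 'a tm) \<Rightarrow> bool" where
  "poly_time_on C alg \<longleftrightarrow> (\<exists>c e. \<forall>I. C I \<longrightarrow> time (alg I) \<le> c * inst_size I ^ e + c)"

text \<open>
  The first component of the output is the value reported by the algorithm, the second component is
  the solution.  The ratio may depend on the instance.
\<close>

definition approximation_algorithm ::
    "(mrmd \<Rightarrow> real) \<Rightarrow> (mrmd \<Rightarrow> bool) \<Rightarrow> (mrmd \<Rightarrow> (nat \<times> solution) tm) \<Rightarrow> bool" where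
  "approximation_algorithm \<alpha> C alg \<longleftrightarrow>
     (\<forall>I. C I \<longrightarrow> \<alpha> I \<ge> 1 \<and> feasible I (snd (result (alg I))) \<and>
        real (objective I (snd (result (alg I)))) \<ge> 1 / \<alpha> I * real (opt I)) \<and>
     poly_time_on C alg"

definition is_1R1D :: "mrmd \<Rightarrow> bool" where
  "is_1R1D I \<longleftrightarrow> wf_mrmd I \<and>
     (\<exists>r. rtypes I = [r] \<and> (\<forall>d\<in>set (demands I). req I d = [r]))"

text \<open>
  The last conjunct says that producing the output takes at least as long as writing it down, which
  a cost annotation, unlike a machine model, does not enforce by itself.
\<close>

definition poly_time_1R1D_solver :: "(mrmd \<Rightarrow> solution tm) \<Rightarrow> bool" where
  "poly_time_1R1D_solver solver \<longleftrightarrow>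
     (\<forall>J. is_1R1D J \<longrightarrow>
        feasible J (result (solver J)) \<and> objective J (result (solver J)) = opt J) \<and>
     poly_time_on is_1R1D solver \<and>
     (\<forall>J. is_1R1D J \<longrightarrow> sol_size (result (solver J)) \<le> time (solver J))"

definition restrict_1R1D :: "mrmd \<Rightarrow> nat \<Rightarrow> nat list \<Rightarrow> mrmd" where
  "restrict_1R1D I r ds = I\<lparr>demands := ds, rtypes := [r], req := (\<lambda>_. [r])\<rparr>"

fun member_tm :: "nat \<Rightarrow> nat list \<Rightarrow> bool tm" where
  "member_tm x [] = return_tm False"
| "member_tm x (y # ys) = do {
     b \<leftarrow> eq_tm x y;
     if b then return_tm True else do { c \<leftarrow> member_tm x ys; return_tm c } }"

fun sum_amounts_tm :: "mrmd \<Rightarrow> nat \<Rightarrow> nat list \<Rightarrow> nat tm" where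
  "sum_amounts_tm I r [] = return_tm 0"
| "sum_amounts_tm I r (s # ss) = do {
     a \<leftarrow> lookup_tm I (amount I r s);
     m \<leftarrow> sum_amounts_tm I r ss;
     n \<leftarrow> add_tm a m;
     return_tm n }"

definition num_resources_tm :: "mrmd \<Rightarrow> nat \<Rightarrow> nat tm" where
  "num_resources_tm I r = do {
     ss \<leftarrow> lookup_tm I (starts I r);
     sum_amounts_tm I r ss }"

text \<open>
  Insertion sort of the types by their number of resources.  Types with equally many resources keep
  their relative order from \<open>rtypes I\<close>, which is arbitrary.
\<close>

fun insert_type_tm :: "mrmd \<Rightarrow> nat \<Rightarrow> nat list \<Rightarrow> nat list tm" where
  "insert_type_tm I r [] = return_tm [r]"
| "insert_type_tm I r (q # qs) = do {
     m \<leftarrow> num_resources_tm I r;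
     n \<leftarrow> num_resources_tm I q;
     b \<leftarrow> le_tm m n;
     if b then return_tm (r # q # qs)
     else do { rs \<leftarrow> insert_type_tm I r qs; return_tm (q # rs) } }"

fun sort_types_tm :: "mrmd \<Rightarrow> nat list \<Rightarrow> nat list tm" where
  "sort_types_tm I [] = return_tm []"
| "sort_types_tm I (r # rs) = do { qs \<leftarrow> sort_types_tm I rs; insert_type_tm I r qs }"

fun split_demands_tm :: "mrmd \<Rightarrow> nat \<Rightarrow> nat list \<Rightarrow> (nat list \<times> nat list) tm" where
  "split_demands_tm I r [] = return_tm ([], [])"
| "split_demands_tm I r (d # ds) = do {
     M \<leftarrow> lookup_tm I (req I d);
     b \<leftarrow> member_tm r M;
     (ys, ns) \<leftarrow> split_demands_tm I r ds;
     charge (Suc (nbits d)) (if b then (d # ys, ns) else (ys, d # ns)) }"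

fun on_some_path_tm :: "nat \<Rightarrow> solution \<Rightarrow> bool tm" where
  "on_some_path_tm d [] = return_tm False"
| "on_some_path_tm d ((x, p) # S) = do {
     b \<leftarrow> member_tm d p;
     if b then return_tm True else do { c \<leftarrow> on_some_path_tm d S; return_tm c } }"

fun value_1R1D_tm :: "mrmd \<Rightarrow> solution \<Rightarrow> nat list \<Rightarrow> nat tm" where
  "value_1R1D_tm I S [] = return_tm 0"
| "value_1R1D_tm I S (d # ds) = do {
     v \<leftarrow> value_1R1D_tm I S ds;
     b \<leftarrow> on_some_path_tm d S;
     if b then do { w \<leftarrow> lookup_tm I (reward I d); u \<leftarrow> add_tm w v; return_tm u }
     else return_tm v }"

text \<open>
  The recorded solution is that of a single-type subproblem; it is turned into a solution of the
  whole instance only once, after the loop.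
\<close>

fun loop_tm :: "(mrmd \<Rightarrow> solution tm) \<Rightarrow> mrmd \<Rightarrow> nat list \<Rightarrow> nat list \<Rightarrow> nat \<Rightarrow> solution
    \<Rightarrow> (nat \<times> solution) tm" where
  "loop_tm solver I [] ds best S = return_tm (best, S)"
| "loop_tm solver I (r # rs) ds best S = do {
     (Dr, ds') \<leftarrow> split_demands_tm I r ds;
     J \<leftarrow> charge (inst_size I) (restrict_1R1D I r Dr);
     T \<leftarrow> solver J;
     v \<leftarrow> value_1R1D_tm I T Dr;
     b \<leftarrow> le_tm best v;
     if b then do { z \<leftarrow> loop_tm solver I rs ds' v T; return_tm z }
     else do { z \<leftarrow> loop_tm solver I rs ds' best S; return_tm z } }"

text \<open>
  For each resource \<open>(r, s, k)\<close> used by the recorded solution and each type \<open>q\<close>, the resource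
  \<open>(q, s, k)\<close> follows the path of \<open>(r, s, k)\<close>, serving the demands on it that require \<open>q\<close>.
\<close>

fun path_for_type_tm :: "mrmd \<Rightarrow> nat \<Rightarrow> nat list \<Rightarrow> nat list tm" where
  "path_for_type_tm I q [] = return_tm []"
| "path_for_type_tm I q (d # p) = do {
     M \<leftarrow> lookup_tm I (req I d);
     b \<leftarrow> member_tm q M;
     p' \<leftarrow> path_for_type_tm I q p;
     if b then charge (Suc (nbits d)) (d # p') else return_tm p' }"

fun follow_tm :: "mrmd \<Rightarrow> resource \<Rightarrow> nat list \<Rightarrow> nat list \<Rightarrow> solution tm" where
  "follow_tm I (r, s, k) p [] = return_tm []"
| "follow_tm I (r, s, k) p (q # qs) = do {
     p' \<leftarrow> path_for_type_tm I q p;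
     S \<leftarrow> follow_tm I (r, s, k) p qs;
     if p' = [] then return_tm S
     else charge (Suc (nbits q + nbits s + nbits k)) (((q, s, k), p') # S) }"

fun append_tm :: "solution \<Rightarrow> solution \<Rightarrow> solution tm" where
  "append_tm [] T = return_tm T"
| "append_tm (x # S) T = do { U \<leftarrow> append_tm S T; charge (Suc (sol_size [x])) (x # U) }"

fun expand_tm :: "mrmd \<Rightarrow> solution \<Rightarrow> solution tm" where
  "expand_tm I [] = return_tm []"
| "expand_tm I ((x, p) # S) = do {
     T \<leftarrow> follow_tm I x p (rtypes I);
     U \<leftarrow> expand_tm I S;
     append_tm T U }"

definition algorithm_A :: "(mrmd \<Rightarrow> solution tm) \<Rightarrow> mrmd \<Rightarrow> (nat \<times> solution) tm" where
  "algorithm_A solver I = do {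
     rs \<leftarrow> sort_types_tm I (rtypes I);
     (best, S) \<leftarrow> loop_tm solver I rs (demands I) 0 [];
     S' \<leftarrow> expand_tm I S;
     return_tm (best, S') }"

end

theory Submission
  imports Defs
begin

text \<open>
  Every demand belongs to the set \<open>D\<^sup>r\<close> of exactly one iteration, and by the triangle inequality the
  type-\<open>r\<close> paths of an optimal solution remain feasible when restricted to \<open>D\<^sup>r\<close>.  So the optimum is
  at most the sum of the \<open>|R|\<close> subproblem values, hence at most \<open>|R|\<close> times the largest one.
  Conversely, the demands left in iteration \<open>r\<close> only require types with at least \<open>m\<^sub>r\<close> resources,
  all at the common starting location, so there are enough resources of each such type to follow
  those of type \<open>r\<close>.
\<close>

section \<open>Paths\<close>

text \<open>A resource is named by its type, its starting location and an index \<open>k\<close>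
  below the amount there. With a common start, having at least as many resources of type
  \<open>q\<close> as of type \<open>r\<close> makes \<open>(q, s, k)\<close> exist whenever
  \<open>(r, s, k)\<close> does, so no matching between resources has to be chosen. All entries of a
  single-type solution differ in \<open>(s, k)\<close>, so the copies for one type never collide.

  Amounts are written in binary, so the number of resources may be exponential in the size of the
  instance. The time analysis therefore never counts resources. It counts the entries of the
  solver's answers, whose written length is at most the solver's running time. No subinstance is
  larger than the whole instance, so one number bounds all solver calls and all recorded solutions.
  Sums of amounts and rewards stay short because binary length is subadditive.\<close>

text \<open>By the triangle inequality, serving \<open>i\<close>, then \<open>j\<close>, then
  \<open>l\<close> allows going from \<open>i\<close> to \<open>l\<close> directly, and reaching the
  first demand in time implies reaching every later one. The pairwise form passes to subsequences
  and keeps the type apart from the timing, so that a path can be handed to another type.\<close>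

lemma valid_path_iff_sorted_wrt:
  assumes "triangle_ineq I" "s \<in> locations I"
  shows "valid_path I (r, s, k) p \<longleftrightarrow>
    set p \<subseteq> set (demands I) \<and> (\<forall>d\<in>set p. serves_first I r s d) \<and>
    sorted_wrt (\<lambda>i j. stime I i + dur I i + travel I (dloc I i) (dloc I j) \<le> stime I j) p"
    (is "_ \<longleftrightarrow> _ \<and> _ \<and> sorted_wrt ?R p")
proof (cases "set p \<subseteq> set (demands I)")
  case True
  \<comment> \<open>The triangle inequality is known at locations of the instance only, so
    transitivity needs membership in the demand list as part of the relation.\<close>
  define Q where
    "Q i j \<longleftrightarrow> i \<in> set (demands I) \<and> j \<in> set (demands I) \<and> serves_next I r i j" for i j
  have loc: "dloc I d \<in> locations I" if "d \<in> set (demands I)" for d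
    using that by (auto simp: locations_def)
  have tri: "travel I x z \<le> travel I x y + travel I y z"
    if "x \<in> locations I" "y \<in> locations I" "z \<in> locations I" for x y z
    using that assms(1) unfolding triangle_ineq_def by blast
  have "transp Q"
  proof (rule transpI)
    fix i j l assume "Q i j" "Q j l"
    then show "Q i l"
      using tri[of "dloc I i" "dloc I j" "dloc I l"] loc
      unfolding Q_def serves_next_def by fastforce
  qed
  have "successively (serves_next I r) p \<longleftrightarrow> successively Q p"
    by (rule successively_cong) (use True in \<open>auto simp: Q_def\<close>)
  also have "\<dots> \<longleftrightarrow> sorted_wrt Q p"
    using \<open>transp Q\<close> by (rule successively_conv_sorted_wrt)
  finally have path: "valid_path I (r, s, k) p \<longleftrightarrow>
      (p \<noteq> [] \<longrightarrow> serves_first I r s (hd p)) \<and> sorted_wrt Q p"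
    using True by (simp add: valid_path_def)
  have "(p \<noteq> [] \<longrightarrow> serves_first I r s (hd p)) \<and> sorted_wrt Q p \<longleftrightarrow>
      (\<forall>d\<in>set p. serves_first I r s d) \<and> sorted_wrt ?R p" (is "?A \<longleftrightarrow> ?B")
  proof
    assume ?A
    have "serves_first I r s d" if "d \<in> set p" for d
    proof (cases p)
      case (Cons i p')
      show ?thesis
      proof (cases "d = i")
        case False
        then have "Q i d" "serves_first I r s i"
          using \<open>?A\<close> that Cons by auto
        then show ?thesis
          using tri[of s "dloc I i" "dloc I d"] loc assms(2)
          unfolding Q_def serves_first_def serves_next_def by fastforce
      qed (use \<open>?A\<close> Cons in auto)
    qed (use that in simp)
    moreover have "sorted_wrt ?R p"
      using \<open>?A\<close> by (auto intro: sorted_wrt_mono_rel[of p Q] simp: Q_def serves_next_def)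
    ultimately show ?B by blast
  next
    assume ?B
    then show ?A
      using True by (auto intro!: sorted_wrt_mono_rel[of p ?R] simp: Q_def serves_next_def serves_first_def)
  qed
  then show ?thesis using path True by simp
qed (simp add: valid_path_def)

text \<open>Used in both directions: to cut the paths of an optimal solution down to a set of
  demands, and to thin a followed path to the demands of one type.\<close>

lemma valid_path_filter:
  assumes "triangle_ineq I" "s \<in> locations I" "valid_path I (r, s, k) p"
  shows "valid_path I (r, s, k) (filter P p)"
  using assms(3) unfolding valid_path_iff_sorted_wrt[OF assms(1,2)]
  by (auto intro: sorted_wrt_filter)

lemma start_in_locations: "(r, s, k) \<in> resources I \<Longrightarrow> s \<in> locations I"
  by (auto simp: resources_def locations_def)


section \<open>Single-type subproblems\<close>

lemma restrict_1R1D_simps [simp]: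
  "demands (restrict_1R1D I r ds) = ds" "rtypes (restrict_1R1D I r ds) = [r]"
  "req (restrict_1R1D I r ds) d = [r]" "starts (restrict_1R1D I r ds) = starts I"
  "amount (restrict_1R1D I r ds) = amount I" "stime (restrict_1R1D I r ds) = stime I"
  "dur (restrict_1R1D I r ds) = dur I" "reward (restrict_1R1D I r ds) = reward I"
  "dloc (restrict_1R1D I r ds) = dloc I" "travel (restrict_1R1D I r ds) = travel I"
  by (simp_all add: restrict_1R1D_def)

lemma is_1R1D_restrict:
  assumes "wf_mrmd I" "r \<in> set (rtypes I)" "distinct ds" "set ds \<subseteq> set (demands I)"
  shows "is_1R1D (restrict_1R1D I r ds)"
  using assms by (auto simp: is_1R1D_def wf_mrmd_def)

lemma locations_restrict:
  "r \<in> set (rtypes I) \<Longrightarrow> set ds \<subseteq> set (demands I) \<Longrightarrow> locations (restrict_1R1D I r ds) \<subseteq> locations I"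
  by (auto simp: locations_def)

lemma finite_locations [simp]: "finite (locations I)"
  by (auto simp: locations_def)

text \<open>Replacing the requirements of \<open>d\<close> by \<open>[r]\<close> cannot lengthen its
  description because \<open>r\<close> is already among them. A time bound for the solver on
  subinstances thus becomes one in terms of \<open>inst_size I\<close>.\<close>

lemma inst_size_restrict:
  assumes "r \<in> set (rtypes I)" "set ds \<subseteq> set (demands I)" "\<And>d. d \<in> set ds \<Longrightarrow> r \<in> set (req I d)"
  shows "inst_size (restrict_1R1D I r ds) \<le> inst_size I"
proof -
  note loc = locations_restrict[OF assms(1,2)]
  have "(\<Sum>x\<in>locations (restrict_1R1D I r ds). \<Sum>y\<in>locations (restrict_1R1D I r ds). nbits (travel I x y))
      \<le> (\<Sum>x\<in>locations I. \<Sum>y\<in>locations I. nbits (travel I x y))"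
    using loc by (intro order_trans[OF sum_mono sum_mono2] sum_mono2) auto
  moreover have "(\<Sum>d\<in>set ds. nbits d + nbits r + nbits (stime I d)
         + nbits (dur I d) + nbits (reward I d) + nbits (dloc I d))
      \<le> (\<Sum>d\<in>set ds. nbits d + (\<Sum>r\<in>set (req I d). nbits r) + nbits (stime I d)
         + nbits (dur I d) + nbits (reward I d) + nbits (dloc I d))"
    using assms(3) by (intro sum_mono add_mono member_le_sum) auto
  moreover have "\<dots> \<le> (\<Sum>d\<in>set (demands I). nbits d + (\<Sum>r\<in>set (req I d). nbits r)
         + nbits (stime I d) + nbits (dur I d) + nbits (reward I d) + nbits (dloc I d))"
    using assms(2) by (intro sum_mono2) auto
  moreover have "nbits r + (\<Sum>s\<in>set (starts I r). nbits s + nbits (amount I r s))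
      \<le> (\<Sum>r\<in>set (rtypes I). nbits r + (\<Sum>s\<in>set (starts I r). nbits s + nbits (amount I r s)))"
    using assms(1) by (intro member_le_sum) auto
  ultimately show ?thesis
    by (simp add: inst_size_def)
qed

text \<open>The subproblem is a relaxation: the type-\<open>r\<close> entries of \<open>S\<close>,
  with paths filtered to \<open>ds\<close>, are feasible for it, and a demand of \<open>ds\<close>
  met by \<open>S\<close> lies on one of these paths.\<close>

lemma sum_met_le_opt_restrict:
  assumes "triangle_ineq I" "feasible I S"
    and r: "r \<in> set (rtypes I)" and ds: "set ds \<subseteq> set (demands I)"
    and req: "\<And>d. d \<in> set ds \<Longrightarrow> r \<in> set (req I d)"
  shows "(\<Sum>d\<in>{d \<in> set ds. met I S d}. reward I d) \<le> opt (restrict_1R1D I r ds)"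
proof -
  let ?J = "restrict_1R1D I r ds"
  define T where "T = map (\<lambda>(x, p). (x, filter (\<lambda>d. d \<in> set ds) p)) (filter (\<lambda>(x, p). fst x = r) S)"
  have fstT: "map fst T = map fst (filter (\<lambda>(x, p). fst x = r) S)"
    by (auto simp: T_def)
  have "distinct (map fst T)"
    using assms(2) unfolding fstT feasible_def by (auto intro: distinct_map_filter)
  moreover have "x \<in> resources ?J \<and> valid_path ?J x p" if "(x, p) \<in> set T" for x p
  proof -
    from that obtain s k p0 where *: "x = (r, s, k)" "((r, s, k), p0) \<in> set S"
      "p = filter (\<lambda>d. d \<in> set ds) p0"
      by (auto simp: T_def)
    then have res: "(r, s, k) \<in> resources I" and "valid_path I (r, s, k) p0"
      using assms(2) by (auto simp: feasible_def)
    then have "valid_path I (r, s, k) p"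
      using valid_path_filter[OF assms(1)] start_in_locations *(3) by blast
    moreover have "set p \<subseteq> set ds" using *(3) by auto
    ultimately have "valid_path ?J (r, s, k) p"
      by (auto simp: valid_path_def serves_first_def serves_next_def elim!: successively_mono)
    then show ?thesis using *(1) res by (auto simp: resources_def)
  qed
  ultimately have "feasible ?J T"
    by (auto simp: feasible_def)
  then have "objective ?J T \<le> opt ?J"
    by (rule objective_le_opt)
  moreover have "met ?J T d" if d: "d \<in> set ds" "met I S d" for d
  proof -
    obtain s k p where "((r, s, k), p) \<in> set S" "d \<in> set p"
      using d req unfolding met_def by blast
    then have "((r, s, k), filter (\<lambda>d. d \<in> set ds) p) \<in> set T"
      by (force simp: T_def)
    then show ?thesis
      using \<open>d \<in> set p\<close> d(1) unfolding met_def by force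
  qed
  then have "(\<Sum>d\<in>{d \<in> set ds. met I S d}. reward I d) \<le> objective ?J T"
    unfolding objective_def by (auto intro!: sum_mono2)
  ultimately show ?thesis by simp
qed


section \<open>Results of the programs\<close>

lemma bind_tm_simps [simp]:
  "result (bind_tm m f) = result (f (result m))"
  "time (bind_tm m f) = time m + time (f (result m))"
  by (simp_all add: bind_tm_def)

lemma charge_simps [simp]: "result (charge c x) = x" "time (charge c x) = c"
  by (simp_all add: charge_def)

lemma arith_tm_simps [simp]:
  "result (eq_tm m n) = (m = n)" "time (eq_tm m n) = nbits m + nbits n"
  "result (le_tm m n) = (m \<le> n)" "time (le_tm m n) = nbits m + nbits n"
  "result (add_tm m n) = m + n" "time (add_tm m n) = nbits m + nbits n"
  "result (lookup_tm I x) = x" "time (lookup_tm I x) = inst_size I"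
  by (simp_all add: eq_tm_def le_tm_def add_tm_def lookup_tm_def)

lemma result_member_tm [simp]: "result (member_tm x ys) \<longleftrightarrow> x \<in> set ys"
  by (induction ys) auto

lemma result_sum_amounts_tm [simp]:
  "result (sum_amounts_tm I r ss) = sum_list (map (amount I r) ss)"
  by (induction ss) auto

definition num_resources :: "mrmd \<Rightarrow> nat \<Rightarrow> nat" where
  "num_resources I r = sum_list (map (amount I r) (starts I r))"

lemma result_num_resources_tm [simp]: "result (num_resources_tm I r) = num_resources I r"
  by (simp add: num_resources_tm_def num_resources_def)

lemma result_insert_type_tm [simp]:
  "result (insert_type_tm I r qs) = insort_key (num_resources I) r qs"
  by (induction qs) auto

lemma result_sort_types_tm [simp]:
  "result (sort_types_tm I rs) = sort_key (num_resources I) rs"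
  by (induction rs) auto

lemma result_split_demands_tm [simp]:
  "result (split_demands_tm I r ds) =
    (filter (\<lambda>d. r \<in> set (req I d)) ds, filter (\<lambda>d. r \<notin> set (req I d)) ds)"
  by (induction ds) auto

lemma result_on_some_path_tm [simp]:
  "result (on_some_path_tm d S) \<longleftrightarrow> (\<exists>(x, p)\<in>set S. d \<in> set p)"
  by (induction d S rule: on_some_path_tm.induct) auto

lemma result_value_1R1D_tm:
  "distinct ds \<Longrightarrow> result (value_1R1D_tm I S ds) =
    (\<Sum>d\<in>{d \<in> set ds. \<exists>(x, p)\<in>set S. d \<in> set p}. reward I d)"
proof (induction ds)
  case (Cons d ds)
  have "{d' \<in> set (d # ds). \<exists>(x, p)\<in>set S. d' \<in> set p} =
      (if \<exists>(x, p)\<in>set S. d \<in> set p then {d} else {}) \<union> {d' \<in> set ds. \<exists>(x, p)\<in>set S. d' \<in> set p}"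
    by auto
  then show ?case
    using Cons by (auto simp: sum.insert_if)
qed simp

text \<open>Feasibility forces every entry of \<open>T\<close> to have type \<open>r\<close>, the
  only type required, so lying on some path is the same as being met.\<close>

lemma result_value_restrict:
  assumes "distinct ds" "feasible (restrict_1R1D I r ds) T"
  shows "result (value_1R1D_tm I T ds) = objective (restrict_1R1D I r ds) T"
proof -
  have "(\<exists>(x, p)\<in>set T. d \<in> set p) \<longleftrightarrow> met (restrict_1R1D I r ds) T d" for d
    using assms(2) unfolding met_def feasible_def resources_def by fastforce
  then show ?thesis
    using assms(1) by (simp add: result_value_1R1D_tm objective_def)
qed

lemma result_path_for_type_tm [simp]:
  "result (path_for_type_tm I q p) = filter (\<lambda>d. q \<in> set (req I d)) p"
  by (induction p) auto

lemma result_follow_tm [simp]: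
  "result (follow_tm I (r, s, k) p qs) =
    map (\<lambda>q. ((q, s, k), filter (\<lambda>d. q \<in> set (req I d)) p))
      (filter (\<lambda>q. \<exists>d\<in>set p. q \<in> set (req I d)) qs)"
  by (induction qs) (auto simp: filter_empty_conv)

lemma result_append_tm [simp]: "result (append_tm S T) = S @ T"
  by (induction S) auto

text \<open>The condition \<open>p' \<noteq> []\<close> is essential for feasibility: a type with
  too few resources may lack \<open>(q, s, k)\<close>, and such a type is required by no demand on
  the path.\<close>

lemma in_set_expand_iff:
  "((q, s, k), p') \<in> set (result (expand_tm I S)) \<longleftrightarrow>
    q \<in> set (rtypes I) \<and> p' \<noteq> [] \<and>
    (\<exists>r p. ((r, s, k), p) \<in> set S \<and> p' = filter (\<lambda>d. q \<in> set (req I d)) p)"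
proof (induction S)
  case (Cons xp S)
  obtain r' s' k' p where "xp = ((r', s', k'), p)" by (metis prod.exhaust)
  moreover have "((q, s, k), p') \<in> set (result (follow_tm I (r', s', k') p (rtypes I))) \<longleftrightarrow>
      q \<in> set (rtypes I) \<and> p' \<noteq> [] \<and> s' = s \<and> k' = k \<and> p' = filter (\<lambda>d. q \<in> set (req I d)) p"
    by (auto simp: filter_empty_conv)
  ultimately show ?case
    using Cons by (auto simp del: result_follow_tm)
qed simp


section \<open>Expanding a single-type solution\<close>

text \<open>One entry \<open>(r, s, k)\<close> is spread over all types with the same
  \<open>s\<close> and \<open>k\<close>, so the pairs \<open>(s, k)\<close> have to be distinct, not
  only the triples.\<close>

lemma distinct_expand:
  assumes "distinct (rtypes I)" "distinct (map (\<lambda>(x, p). snd x) S)"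
  shows "distinct (map fst (result (expand_tm I S)))"
  using assms(2)
proof (induction S)
  case (Cons xp S)
  obtain r s k p where xp: "xp = ((r, s, k), p)" by (metis prod.exhaust)
  have notin: "(s, k) \<notin> snd ` fst ` set (result (expand_tm I S))"
  proof
    assume "(s, k) \<in> snd ` fst ` set (result (expand_tm I S))"
    then obtain q p' where "((q, s, k), p') \<in> set (result (expand_tm I S))" by force
    then show False using Cons.prems xp in_set_expand_iff by force
  qed
  let ?F = "result (follow_tm I (r, s, k) p (rtypes I))"
  have "map fst ?F = map (\<lambda>q. (q, s, k)) (filter (\<lambda>q. \<exists>d\<in>set p. q \<in> set (req I d)) (rtypes I))"
    by simp
  then have F: "distinct (map fst ?F)" "snd ` fst ` set ?F \<subseteq> {(s, k)}"
    using assms(1) by (auto simp: distinct_map inj_on_def)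
  have "fst ` set ?F \<inter> fst ` set (result (expand_tm I S)) = {}"
  proof (rule equals0I, elim IntE)
    fix x
    assume "x \<in> fst ` set ?F" "x \<in> fst ` set (result (expand_tm I S))"
    then have "snd x \<in> snd ` fst ` set ?F" and x: "snd x \<in> snd ` fst ` set (result (expand_tm I S))"
      by (blast intro: imageI)+
    from F(2) this(1) have "snd x \<in> {(s, k)}"
      by (rule subsetD)
    then have "snd x = (s, k)"
      by (rule singletonD)
    with notin x show False
      by metis
  qed
  then show ?case
    using F(1) Cons by (simp add: xp del: result_follow_tm)
qed simp

text \<open>A type may list further starting locations, but their amounts are zero, so the whole
  supply sits at \<open>s0\<close>.\<close>

lemma amount_eq_num_resources:
  assumes "wf_mrmd I" "\<And>r s k. (r, s, k) \<in> resources I \<Longrightarrow> s = s0"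
    "q \<in> set (rtypes I)" "0 < num_resources I q"
  shows "s0 \<in> set (starts I q) \<and> amount I q s0 = num_resources I q"
proof -
  have eq: "num_resources I q = (\<Sum>s\<in>set (starts I q). amount I q s)"
    using assms(1,3) unfolding num_resources_def wf_mrmd_def by (simp add: sum_list_distinct_conv_sum_set)
  \<comment> \<open>A positive amount yields the resource with index 0, and that resource starts at
    \<open>s0\<close>.\<close>
  have 0: "s = s0" if "s \<in> set (starts I q)" "amount I q s > 0" for s
    using assms(2)[of q s 0] that assms(3) by (auto simp: resources_def)
  have "s0 \<in> set (starts I q)"
  proof (rule ccontr)
    assume "s0 \<notin> set (starts I q)"
    then have "num_resources I q = 0" using 0 eq by fastforce
    then show False using assms(4) by simp
  qed
  moreover have "(\<Sum>s\<in>set (starts I q) - {s0}. amount I q s) = 0"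
    using 0 by fastforce
  ultimately show ?thesis
    using eq by (simp add: sum.remove)
qed

lemma resource_other_type:
  assumes "wf_mrmd I" "same_start I" "(r, s, k) \<in> resources I" "q \<in> set (rtypes I)"
    "num_resources I r \<le> num_resources I q"
  shows "(q, s, k) \<in> resources I"
proof -
  obtain s0 where s0: "\<And>r s k. (r, s, k) \<in> resources I \<Longrightarrow> s = s0"
    using assms(2) unfolding same_start_def by blast
  have r: "r \<in> set (rtypes I)" "s = s0" "s \<in> set (starts I r)" "k < amount I r s"
    using assms(3) s0 by (auto simp: resources_def)
  then have "k < num_resources I r"
    unfolding num_resources_def using member_le_sum_list[of "amount I r s" "map (amount I r) (starts I r)"] by simp
  then have "k < num_resources I q" using assms(5) by simp
  then have "s0 \<in> set (starts I q)" "k < amount I q s0"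
    using amount_eq_num_resources[OF assms(1) s0 assms(4)] by auto
  then show ?thesis using r(2) assms(4) by (simp add: resources_def)
qed

text \<open>Times and travel times do not depend on the type: a thinned path is valid for
  \<open>q\<close> once all its demands require \<open>q\<close>. Hypothesis \<open>num\<close>
  supplies the resource that follows it.\<close>

lemma expand_restrict:
  assumes wf: "wf_mrmd I" and tri: "triangle_ineq I" and same: "same_start I"
    and r: "r \<in> set (rtypes I)" and ds: "set ds \<subseteq> set (demands I)"
    and num: "\<And>d q. d \<in> set ds \<Longrightarrow> q \<in> set (req I d) \<Longrightarrow> num_resources I r \<le> num_resources I q"
    and T: "feasible (restrict_1R1D I r ds) T"
  shows "feasible I (result (expand_tm I T))"
    and "objective (restrict_1R1D I r ds) T \<le> objective I (result (expand_tm I T))"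
proof -
  let ?J = "restrict_1R1D I r ds" and ?E = "result (expand_tm I T)"
  have triJ: "triangle_ineq ?J"
    using tri locations_restrict[OF r ds] unfolding triangle_ineq_def restrict_1R1D_simps by (meson subsetD)
  have T': "r' = r \<and> (r, s, k) \<in> resources I \<and> s \<in> locations ?J \<and> valid_path ?J (r, s, k) p \<and> set p \<subseteq> set ds"
    if "((r', s, k), p) \<in> set T" for r' s k p
  proof -
    have "(r', s, k) \<in> resources ?J" "valid_path ?J (r', s, k) p"
      using T that by (auto simp: feasible_def)
    then show ?thesis using r start_in_locations[of r' s k ?J]
      by (auto simp: resources_def valid_path_def)
  qed
  \<comment> \<open>All entries have the same type \<open>r\<close>, so distinct resources have
    distinct pairs \<open>(s, k)\<close>.\<close>
  have "map fst T = map (\<lambda>(x, p). (r, snd x)) T"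
    using T' by (auto intro!: map_cong)
  then have "distinct (map (\<lambda>(x, p). (r, snd x)) T)"
    using T unfolding feasible_def by metis
  then have "distinct (map (\<lambda>(x, p). snd x) T)"
    by (auto simp: distinct_map inj_on_def case_prod_beta)
  then have "distinct (map fst ?E)"
    using wf by (intro distinct_expand) (auto simp: wf_mrmd_def)
  moreover have "(q, s, k) \<in> resources I \<and> valid_path I (q, s, k) p'"
    if in_E: "((q, s, k), p') \<in> set ?E" for q s k p'
  proof -
    obtain r' p where p: "q \<in> set (rtypes I)" "p' \<noteq> []" "((r', s, k), p) \<in> set T"
      "p' = filter (\<lambda>d. q \<in> set (req I d)) p"
      using in_E unfolding in_set_expand_iff by blast
    note T'' = T'[OF p(3)]
    \<comment> \<open>The head is a demand of \<open>ds\<close> requiring \<open>q\<close>, to which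
      \<open>num\<close> applies.\<close>
    have "hd p' \<in> set p'" using p(2) by simp
    then have "num_resources I r \<le> num_resources I q"
      using num p(4) T'' by auto
    then have res: "(q, s, k) \<in> resources I"
      using resource_other_type[OF wf same] T'' p(1) by blast
    have "s \<in> locations I" using T'' start_in_locations by blast
    have "s \<in> locations ?J" "valid_path ?J (r, s, k) p'"
      using valid_path_filter[OF triJ] T'' p(4) by blast+
    note pathJ = this(2)[unfolded valid_path_iff_sorted_wrt[OF triJ this(1)] restrict_1R1D_simps]
    have "\<forall>d\<in>set p'. q \<in> set (req I d)" using p(4) by auto
    then have "valid_path I (q, s, k) p'"
      using pathJ ds unfolding valid_path_iff_sorted_wrt[OF tri \<open>s \<in> locations I\<close>]
      by (auto simp: serves_first_def)
    with res show ?thesis by blast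
  qed
  ultimately show "feasible I ?E"
    by (auto simp: feasible_def)
  have "met I ?E d" if "d \<in> set ds" "met ?J T d" for d
  proof -
    obtain s k p where p: "((r, s, k), p) \<in> set T" "d \<in> set p"
      using \<open>met ?J T d\<close> by (auto simp: met_def)
    have "((q, s, k), filter (\<lambda>d. q \<in> set (req I d)) p) \<in> set ?E" if "q \<in> set (req I d)" for q
    proof -
      have "q \<in> set (rtypes I)"
        using that \<open>d \<in> set ds\<close> ds wf by (auto simp: wf_mrmd_def)
      then show ?thesis
        using p that unfolding in_set_expand_iff by (auto simp: filter_empty_conv)
    qed
    then show ?thesis
      using p(2) unfolding met_def by fastforce
  qed
  then show "objective ?J T \<le> objective I ?E"
    using ds unfolding objective_def by (auto intro!: sum_mono2)
qed


section \<open>The approximation guarantee\<close>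

text \<open>\<open>S\<close> is any fixed feasible solution to compare with, later an optimal one.
  The invariant on \<open>T\<close> concerns its expansion, because \<open>T\<close> may stem from a
  subproblem of an earlier type. Remaining demands require only types still in \<open>rs\<close>; as
  \<open>rs\<close> is sorted, its head has the fewest resources among them.\<close>

lemma loop_guarantee:
  assumes wf: "wf_mrmd I" and tri: "triangle_ineq I" and same: "same_start I"
    and solver: "\<And>J. is_1R1D J \<Longrightarrow>
      feasible J (result (solver J)) \<and> objective J (result (solver J)) = opt J"
    and "feasible I S"
    and "set rs \<subseteq> set (rtypes I)" "sorted_wrt (\<lambda>r q. num_resources I r \<le> num_resources I q) rs"
    and "distinct ds" "set ds \<subseteq> set (demands I)" "\<And>d. d \<in> set ds \<Longrightarrow> set (req I d) \<subseteq> set rs"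
    and "feasible I (result (expand_tm I T))" "best \<le> objective I (result (expand_tm I T))"
    and "result (loop_tm solver I rs ds best T) = (v, U)"
  shows "feasible I (result (expand_tm I U)) \<and> v \<le> objective I (result (expand_tm I U)) \<and>
    best \<le> v \<and> (\<Sum>d\<in>{d \<in> set ds. met I S d}. reward I d) \<le> length rs * v"
  using assms(6-)
proof (induction rs arbitrary: ds best T)
  case Nil
  \<comment> \<open>A demand left over would require some type, but no type is left.\<close>
  then have "ds = []"
    using wf unfolding wf_mrmd_def by (cases ds) auto
  then show ?case using Nil by auto
next
  case (Cons r rs)
  define Dr where "Dr = filter (\<lambda>d. r \<in> set (req I d)) ds"
  define ds' where "ds' = filter (\<lambda>d. r \<notin> set (req I d)) ds"
  define J where "J = restrict_1R1D I r Dr"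
  define X where "X = result (solver J)"
  define best' where "best' = (if best \<le> objective J X then objective J X else best)"
  define T' where "T' = (if best \<le> objective J X then X else T)"
  have r: "r \<in> set (rtypes I)" and Dr: "set Dr \<subseteq> set (demands I)" "distinct Dr"
    using Cons.prems by (auto simp: Dr_def)
  have X: "feasible J X" "objective J X = opt J"
    using solver is_1R1D_restrict[OF wf r Dr(2,1)] unfolding X_def J_def by auto
  have num: "num_resources I r \<le> num_resources I q" if "d \<in> set Dr" "q \<in> set (req I d)" for d q
  proof -
    have "q \<in> set (r # rs)" using that Cons.prems(5) by (auto simp: Dr_def)
    then show ?thesis using Cons.prems(2) by auto
  qed
  note E = expand_restrict[OF wf tri same r Dr(1) num X(1)[unfolded J_def], folded J_def]
  have "result (loop_tm solver I rs ds' best' T') = (v, U)"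
    using Cons.prems(8) result_value_restrict[OF Dr(2) X(1)[unfolded J_def]]
    by (simp add: Dr_def[symmetric] ds'_def[symmetric] J_def[symmetric] X_def[symmetric]
        best'_def T'_def split: if_splits)
  moreover have "set (req I d) \<subseteq> set rs" if "d \<in> set ds'" for d
    using that Cons.prems(5)[of d] by (auto simp: ds'_def)
  moreover have "feasible I (result (expand_tm I T'))" "best' \<le> objective I (result (expand_tm I T'))"
    using E Cons.prems(6,7) by (auto simp: T'_def best'_def)
  ultimately have IH: "feasible I (result (expand_tm I U))" "v \<le> objective I (result (expand_tm I U))"
    "best' \<le> v" "(\<Sum>d\<in>{d \<in> set ds'. met I S d}. reward I d) \<le> length rs * v"
    using Cons.IH[of ds' T' best'] Cons.prems(1-4) by (auto simp: ds'_def)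
  have "{d \<in> set ds. met I S d} = {d \<in> set Dr. met I S d} \<union> {d \<in> set ds'. met I S d}"
    "{d \<in> set Dr. met I S d} \<inter> {d \<in> set ds'. met I S d} = {}"
    by (auto simp: Dr_def ds'_def)
  then have "(\<Sum>d\<in>{d \<in> set ds. met I S d}. reward I d) =
      (\<Sum>d\<in>{d \<in> set Dr. met I S d}. reward I d) + (\<Sum>d\<in>{d \<in> set ds'. met I S d}. reward I d)"
    by (simp add: sum.union_disjoint)
  moreover have "(\<Sum>d\<in>{d \<in> set Dr. met I S d}. reward I d) \<le> opt J"
    unfolding J_def by (rule sum_met_le_opt_restrict[OF tri \<open>feasible I S\<close> r Dr(1)]) (simp add: Dr_def)
  \<comment> \<open>The best value never decreases, so \<open>opt J\<close> is at most the final
    \<open>v\<close>; this iteration thus adds one multiple of \<open>v\<close> to the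
    bound.\<close>
  moreover have "opt J \<le> best'" "best \<le> best'"
    using X(2) by (auto simp: best'_def)
  ultimately show ?case
    using IH by auto
qed

lemma algorithm_A_guarantee:
  assumes "wf_mrmd I" "triangle_ineq I" "same_start I"
    and "\<And>J. is_1R1D J \<Longrightarrow> feasible J (result (solver J)) \<and> objective J (result (solver J)) = opt J"
  shows "feasible I (snd (result (algorithm_A solver I)))"
    and "opt I \<le> length (rtypes I) * objective I (snd (result (algorithm_A solver I)))"
proof -
  obtain S where S: "feasible I S" "objective I S = opt I"
    using opt_attained by blast
  let ?rs = "sort_key (num_resources I) (rtypes I)"
  obtain v U where vU: "result (loop_tm solver I ?rs (demands I) 0 []) = (v, U)"
    by fastforce
  have sorted: "sorted_wrt (\<lambda>r q. num_resources I r \<le> num_resources I q) ?rs"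
    using sorted_sort_key[of "num_resources I" "rtypes I"] by (simp add: sorted_wrt_map)
  \<comment> \<open>The invariant holds initially: the empty record expands to the empty solution,
    of value at least 0, and every required type occurs in the sorted list.\<close>
  have *: "feasible I (result (expand_tm I U)) \<and> v \<le> objective I (result (expand_tm I U)) \<and>
      0 \<le> v \<and> (\<Sum>d\<in>{d \<in> set (demands I). met I S d}. reward I d) \<le> length ?rs * v"
    by (rule loop_guarantee[OF assms S(1) _ sorted _ _ _ _ _ vU])
      (use assms(1) in \<open>auto simp: wf_mrmd_def feasible_def\<close>)
  moreover have out: "snd (result (algorithm_A solver I)) = result (expand_tm I U)"
    by (simp add: algorithm_A_def vU)
  ultimately show "feasible I (snd (result (algorithm_A solver I)))"
    by simp
  have "opt I \<le> length (rtypes I) * v"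
    using * S(2) by (simp add: objective_def)
  also have "\<dots> \<le> length (rtypes I) * objective I (result (expand_tm I U))"
    using * by simp
  finally show "opt I \<le> length (rtypes I) * objective I (snd (result (algorithm_A solver I)))"
    using out by simp
qed


section \<open>Running time\<close>

text \<open>The base \<open>Suc n\<close> is at least 1, so raising an exponent never lowers the
  bound; this allows two bounds to be added with a common exponent.\<close>

definition poly_bounded :: "(nat \<Rightarrow> nat) \<Rightarrow> bool" where
  "poly_bounded f \<longleftrightarrow> (\<exists>c e. \<forall>n. f n \<le> c * Suc n ^ e)"

lemma poly_bounded_const: "poly_bounded (\<lambda>n. c)"
  unfolding poly_bounded_def by (rule exI[of _ c], rule exI[of _ 0]) simp

lemma poly_bounded_power: "poly_bounded (\<lambda>n. n ^ e)"
  unfolding poly_bounded_def by (rule exI[of _ 1], rule exI[of _ e]) (auto intro: power_mono)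

lemma poly_bounded_ident: "poly_bounded (\<lambda>n. n)"
  using poly_bounded_power[of 1] by simp

lemma poly_bounded_add:
  assumes "poly_bounded f" "poly_bounded g"
  shows "poly_bounded (\<lambda>n. f n + g n)"
proof -
  obtain c e c' e' where *: "\<And>n. f n \<le> c * Suc n ^ e" "\<And>n. g n \<le> c' * Suc n ^ e'"
    using assms unfolding poly_bounded_def by blast
  have "f n + g n \<le> (c + c') * Suc n ^ (e + e')" for n
  proof -
    have "Suc n ^ e \<le> Suc n ^ (e + e')" "Suc n ^ e' \<le> Suc n ^ (e + e')"
      by (intro power_increasing; simp)+
    then have "c * Suc n ^ e \<le> c * Suc n ^ (e + e')" "c' * Suc n ^ e' \<le> c' * Suc n ^ (e + e')"
      by (intro mult_le_mono2; simp)+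
    then show ?thesis
      using *[of n] unfolding add_mult_distrib by linarith
  qed
  then show ?thesis unfolding poly_bounded_def by blast
qed

lemma poly_bounded_mult:
  assumes "poly_bounded f" "poly_bounded g"
  shows "poly_bounded (\<lambda>n. f n * g n)"
proof -
  obtain c e c' e' where *: "\<And>n. f n \<le> c * Suc n ^ e" "\<And>n. g n \<le> c' * Suc n ^ e'"
    using assms unfolding poly_bounded_def by blast
  have "f n * g n \<le> (c * c') * Suc n ^ (e + e')" for n
    using mult_le_mono[OF *, of n n] by (simp add: power_add mult_ac del: power_Suc)
  then show ?thesis unfolding poly_bounded_def by blast
qed

lemmas poly_bounded_intros =
  poly_bounded_const poly_bounded_ident poly_bounded_power poly_bounded_add poly_bounded_mult

lemma poly_time_onI:
  assumes "poly_bounded f" "\<And>I. C I \<Longrightarrow> time (alg I) \<le> f (inst_size I)"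
  shows "poly_time_on C alg"
proof -
  obtain c e where *: "\<And>n. f n \<le> c * Suc n ^ e"
    using assms(1) unfolding poly_bounded_def by blast
  \<comment> \<open>The factor \<open>2 ^ e\<close> comes from \<open>Suc n \<le> 2 * n\<close>,
    valid since an instance has size at least 1.\<close>
  have "time (alg I) \<le> (c * 2 ^ e) * inst_size I ^ e + c * 2 ^ e" if "C I" for I
  proof -
    have "Suc (inst_size I) \<le> 2 * inst_size I"
      by (simp add: inst_size_def)
    then have "Suc (inst_size I) ^ e \<le> 2 ^ e * inst_size I ^ e"
      by (metis power_mono power_mult_distrib le0)
    then have "c * Suc (inst_size I) ^ e \<le> c * (2 ^ e * inst_size I ^ e)"
      by (rule mult_le_mono2)
    then show ?thesis
      using assms(2)[OF that] *[of "inst_size I"] unfolding mult.assoc by linarith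
  qed
  then show ?thesis unfolding poly_time_on_def by blast
qed

section \<open>Binary lengths and sizes of solutions\<close>

lemma nbits_0: "nbits 0 = 1"
  by (simp add: nbits_def floorlog_def)

lemma nbits_pos: "1 \<le> nbits n"
  by (simp add: nbits_def)

text \<open>The right-hand side contains two separator bits, the left-hand side one; the spare bit
  pays for the carry.\<close>

lemma nbits_add: "nbits (m + n) \<le> nbits m + nbits n"
proof -
  have less: "x < 2 ^ floorlog 2 x" for x :: nat
    using floorlog_bounds[of x 2] by (cases "x = 0") auto
  have "m + n < 2 ^ floorlog 2 m + 2 ^ floorlog 2 n"
    using less[of m] less[of n] by simp
  also have "\<dots> \<le> 2 ^ (floorlog 2 m + floorlog 2 n) + 2 ^ (floorlog 2 m + floorlog 2 n)"
    by (intro add_mono power_increasing) auto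
  also have "\<dots> = 2 ^ Suc (floorlog 2 m + floorlog 2 n)"
    by simp
  finally have "floorlog 2 (m + n) \<le> Suc (floorlog 2 m + floorlog 2 n)"
    by (intro floorlog_leI) auto
  then show ?thesis by (simp add: nbits_def)
qed

lemma length_le_sum:
  fixes f :: "nat \<Rightarrow> nat"
  assumes "distinct xs" "\<And>x. 1 \<le> f x"
  shows "length xs \<le> sum f (set xs)"
proof -
  have "length xs = (\<Sum>x\<in>set xs. 1)"
    using assms(1) by (simp add: distinct_card)
  also have "\<dots> \<le> sum f (set xs)"
    using assms(2) by (rule sum_mono)
  finally show ?thesis .
qed

lemma sol_size_Nil [simp]: "sol_size [] = 0"
  by (simp add: sol_size_def)

lemma sol_size_Cons: "sol_size (((r, s, k), p) # S) =
    nbits r + nbits s + nbits k + (\<Sum>d\<leftarrow>p. nbits d) + sol_size S"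
  by (simp add: sol_size_def)

lemma length_le_sum_list_nbits: "length p \<le> (\<Sum>d\<leftarrow>p. nbits d)"
  by (induction p) (auto simp: nbits_def)

lemma length_le_sol_size: "length S \<le> sol_size S"
  by (induction S) (auto simp: sol_size_Cons nbits_def)

lemma entry_le_sol_size:
  "((r, s, k), p) \<in> set S \<Longrightarrow> nbits r + nbits s + nbits k + (\<Sum>d\<leftarrow>p. nbits d) \<le> sol_size S"
  by (induction S) (auto simp: sol_size_Cons)

lemma time_member_tm:
  assumes "\<And>y. y \<in> set ys \<Longrightarrow> nbits x + nbits y + 1 \<le> c"
  shows "time (member_tm x ys) \<le> 1 + length ys * c"
  using assms by (induction ys) (auto, fastforce+)

lemma time_append_tm: "time (append_tm S T) \<le> 1 + length S + sol_size S"
  by (induction S) (auto simp: sol_size_Cons)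

text \<open>
  In the following bounds \<open>n\<close> stands for the size of the instance.  The argument \<open>q\<close> bounds the
  running time of the solver on the subproblems, and hence the size of its solutions, except that
  in \<open>scan_bound\<close> it is the length of the scanned list.
\<close>

definition member_bound :: "nat \<Rightarrow> nat" where
  "member_bound n = 1 + n * (2 * n + 1)"

definition num_bound :: "nat \<Rightarrow> nat" where
  "num_bound n = n + (1 + n * (3 * n + 1))"

definition sort_bound :: "nat \<Rightarrow> nat" where
  "sort_bound n = 1 + n * (1 + n * (2 * num_bound n + 2 * n + 1))"

definition scan_bound :: "nat \<Rightarrow> nat \<Rightarrow> nat" where
  "scan_bound n q = 1 + q * (2 * n + member_bound n + 1)"

definition value_bound :: "nat \<Rightarrow> nat \<Rightarrow> nat" where
  "value_bound n q = 1 + n * ((1 + q * (2 + q * (2 * n + 1))) + 3 * n + 1)"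

definition loop_bound :: "nat \<Rightarrow> nat \<Rightarrow> nat" where
  "loop_bound n q = 1 + n * (scan_bound n n + n + q + value_bound n q + 2 * n + 1)"

definition expand_bound :: "nat \<Rightarrow> nat \<Rightarrow> nat" where
  "expand_bound n q = 1 + q * ((1 + n * (scan_bound n q + n + q + 1)) + (1 + n + n * (n + q)))"

section \<open>Step counts of the programs on one well-formed instance\<close>

context
  fixes I :: mrmd
  assumes wf: "wf_mrmd I"
begin

lemma demand_bits:
  assumes "d \<in> set (demands I)"
  shows "nbits d + (\<Sum>r\<in>set (req I d). nbits r) + nbits (reward I d) \<le> inst_size I"
proof -
  let ?f = "\<lambda>d. nbits d + (\<Sum>r\<in>set (req I d). nbits r) + nbits (stime I d)
         + nbits (dur I d) + nbits (reward I d) + nbits (dloc I d)"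
  have "?f d \<le> (\<Sum>d\<in>set (demands I). ?f d)"
    using assms by (intro member_le_sum) auto
  then show ?thesis by (simp add: inst_size_def)
qed

text \<open>The \<open>Suc\<close> is the leading one in \<open>inst_size\<close>. It pays for the
  bit with which \<open>nbits 0 = 1\<close> starts off a sum of amounts.\<close>

lemma type_bits:
  assumes "r \<in> set (rtypes I)"
  shows "Suc (nbits r + (\<Sum>s\<in>set (starts I r). nbits s + nbits (amount I r s))) \<le> inst_size I"
proof -
  let ?f = "\<lambda>r. nbits r + (\<Sum>s\<in>set (starts I r). nbits s + nbits (amount I r s))"
  have "?f r \<le> (\<Sum>r\<in>set (rtypes I). ?f r)"
    using assms by (intro member_le_sum) auto
  then show ?thesis by (simp add: inst_size_def)
qed

lemma nbits_demand: "d \<in> set (demands I) \<Longrightarrow> nbits d \<le> inst_size I"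
  using demand_bits[of d] by linarith

lemma nbits_type: "r \<in> set (rtypes I) \<Longrightarrow> nbits r \<le> inst_size I"
  using type_bits[of r] by linarith

lemma length_req: "d \<in> set (demands I) \<Longrightarrow> length (req I d) \<le> inst_size I"
  using demand_bits[of d] length_le_sum[of "req I d" nbits] wf nbits_pos
  by (fastforce simp: wf_mrmd_def)

lemma length_demand_list:
  assumes "distinct ds" "set ds \<subseteq> set (demands I)"
  shows "length ds \<le> inst_size I"
proof -
  let ?f = "\<lambda>d. nbits d + (\<Sum>r\<in>set (req I d). nbits r) + nbits (stime I d)
         + nbits (dur I d) + nbits (reward I d) + nbits (dloc I d)"
  have "length ds \<le> (\<Sum>d\<in>set ds. ?f d)"
    using assms(1) by (rule length_le_sum) (simp add: nbits_def)
  also have "\<dots> \<le> (\<Sum>d\<in>set (demands I). ?f d)"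
    using assms(2) by (intro sum_mono2) auto
  finally show ?thesis by (simp add: inst_size_def)
qed

lemma length_rtypes: "length (rtypes I) \<le> inst_size I"
proof -
  have "length (rtypes I)
      \<le> (\<Sum>r\<in>set (rtypes I). nbits r + (\<Sum>s\<in>set (starts I r). nbits s + nbits (amount I r s)))"
    using wf by (intro length_le_sum) (auto simp: wf_mrmd_def nbits_def)
  then show ?thesis by (simp add: inst_size_def)
qed

lemma nbits_req: "d \<in> set (demands I) \<Longrightarrow> r \<in> set (req I d) \<Longrightarrow> nbits r \<le> inst_size I"
  using wf nbits_type unfolding wf_mrmd_def by blast

lemma time_member_req:
  assumes "d \<in> set (demands I)" "r \<in> set (rtypes I)"
  shows "time (member_tm r (req I d)) \<le> member_bound (inst_size I)"
proof -
  have "time (member_tm r (req I d)) \<le> 1 + length (req I d) * (2 * inst_size I + 1)"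
    using nbits_req[OF assms(1)] nbits_type[OF assms(2)] by (intro time_member_tm) fastforce
  also have "\<dots> \<le> member_bound (inst_size I)"
    unfolding member_bound_def using length_req[OF assms(1)] by (intro add_mono mult_le_mono) auto
  finally show ?thesis .
qed

lemma nbits_sum_amounts:
  assumes "r \<in> set (rtypes I)" "distinct ss" "set ss \<subseteq> set (starts I r)"
  shows "nbits (sum_list (map (amount I r) ss)) \<le> inst_size I"
proof -
  have "nbits (sum_list (map (amount I r) ss)) \<le> Suc (\<Sum>s\<leftarrow>ss. nbits s + nbits (amount I r s))"
  proof (induction ss)
    case (Cons s ss)
    then show ?case
      using nbits_add[of "amount I r s" "sum_list (map (amount I r) ss)"] by simp
  qed (simp add: nbits_0)
  also have "(\<Sum>s\<leftarrow>ss. nbits s + nbits (amount I r s)) = (\<Sum>s\<in>set ss. nbits s + nbits (amount I r s))"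
    using assms(2) by (rule sum_list_distinct_conv_sum_set)
  also have "\<dots> \<le> (\<Sum>s\<in>set (starts I r). nbits s + nbits (amount I r s))"
    using assms(3) by (intro sum_mono2) auto
  finally show ?thesis using type_bits[OF assms(1)] by simp
qed

text \<open>Each location costs one table access, one addition of two numbers of at most
  \<open>inst_size I\<close> bits each, and a return.\<close>

lemma time_sum_amounts_tm:
  assumes "r \<in> set (rtypes I)" "distinct ss" "set ss \<subseteq> set (starts I r)"
  shows "time (sum_amounts_tm I r ss) \<le> 1 + length ss * (3 * inst_size I + 1)"
  using assms(2,3)
proof (induction ss)
  case (Cons s ss)
  have "nbits (amount I r s) \<le> inst_size I"
    using nbits_sum_amounts[OF assms(1), of "[s]"] Cons.prems by simp
  moreover have "nbits (sum_list (map (amount I r) ss)) \<le> inst_size I"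
    using nbits_sum_amounts[OF assms(1), of ss] Cons.prems by simp
  ultimately show ?case
    using Cons by simp
qed simp

lemma time_num_resources_tm:
  assumes "r \<in> set (rtypes I)"
  shows "time (num_resources_tm I r) \<le> num_bound (inst_size I)"
    and "nbits (num_resources I r) \<le> inst_size I"
proof -
  have dist: "distinct (starts I r)"
    using wf assms by (simp add: wf_mrmd_def)
  then have "length (starts I r) \<le> (\<Sum>s\<in>set (starts I r). nbits s + nbits (amount I r s))"
    by (intro length_le_sum) (auto simp: nbits_def)
  then have "length (starts I r) * (3 * inst_size I + 1) \<le> inst_size I * (3 * inst_size I + 1)"
    using type_bits[OF assms] by (intro mult_le_mono1) linarith
  then show "time (num_resources_tm I r) \<le> num_bound (inst_size I)"
    using time_sum_amounts_tm[OF assms dist]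
    by (simp add: num_resources_tm_def num_bound_def)
  show "nbits (num_resources I r) \<le> inst_size I"
    using nbits_sum_amounts[OF assms dist] by (simp add: num_resources_def)
qed

lemma time_insert_type_tm:
  assumes "r \<in> set (rtypes I)" "set qs \<subseteq> set (rtypes I)"
  shows "time (insert_type_tm I r qs) \<le>
    1 + length qs * (2 * num_bound (inst_size I) + 2 * inst_size I + 1)"
  using assms(2)
proof (induction qs)
  case (Cons q qs)
  then show ?case
    using time_num_resources_tm[of r] time_num_resources_tm[of q] assms(1) by simp
qed simp

lemma time_sort_types_tm: "time (sort_types_tm I (rtypes I)) \<le> sort_bound (inst_size I)"
proof -
  let ?c = "2 * num_bound (inst_size I) + 2 * inst_size I + 1"
  have "time (sort_types_tm I rs) \<le> 1 + length rs * (1 + inst_size I * ?c)"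
    if "set rs \<subseteq> set (rtypes I)" "length rs \<le> inst_size I" for rs
    using that
  proof (induction rs)
    case (Cons r rs)
    let ?qs = "sort_key (num_resources I) rs"
    have "time (insert_type_tm I r ?qs) \<le> 1 + length ?qs * ?c"
      using Cons.prems by (intro time_insert_type_tm) auto
    also have "\<dots> \<le> 1 + inst_size I * ?c"
      using Cons.prems by (intro add_mono mult_le_mono) auto
    finally show ?case using Cons by simp
  qed simp
  then have "time (sort_types_tm I (rtypes I)) \<le> 1 + length (rtypes I) * (1 + inst_size I * ?c)"
    using length_rtypes by blast
  also have "\<dots> \<le> sort_bound (inst_size I)"
    unfolding sort_bound_def using length_rtypes by (intro add_mono mult_le_mono) auto
  finally show ?thesis .
qed

lemma time_split_demands_tm:
  assumes "r \<in> set (rtypes I)" "set ds \<subseteq> set (demands I)"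
  shows "time (split_demands_tm I r ds) \<le> scan_bound (inst_size I) (length ds)"
  using assms(2) unfolding scan_bound_def
proof (induction ds)
  case (Cons d ds)
  then show ?case
    using time_member_req[of d r] nbits_demand[of d] assms(1) by simp
qed simp

lemma time_path_for_type_tm:
  assumes "r \<in> set (rtypes I)" "set p \<subseteq> set (demands I)"
  shows "time (path_for_type_tm I r p) \<le> scan_bound (inst_size I) (length p)"
  using assms(2) unfolding scan_bound_def
proof (induction p)
  case (Cons d p)
  then show ?case
    using time_member_req[of d r] nbits_demand[of d] assms(1) by simp
qed simp

lemma scan_bound_mono: "q \<le> q' \<Longrightarrow> scan_bound n q \<le> scan_bound n q'"
  unfolding scan_bound_def by (intro add_mono mult_le_mono) auto

lemma time_on_some_path_tm:
  assumes "d \<in> set (demands I)" "\<And>r s k p. ((r, s, k), p) \<in> set S \<Longrightarrow> set p \<subseteq> set (demands I) \<and> length p \<le> q"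
  shows "time (on_some_path_tm d S) \<le> 1 + length S * (2 + q * (2 * inst_size I + 1))"
  using assms(2)
proof (induction S)
  case (Cons xp S)
  obtain r s k p where xp: "xp = ((r, s, k), p)" by (metis prod.exhaust)
  then have p: "set p \<subseteq> set (demands I)" "length p \<le> q"
    using Cons.prems[of r s k p] by simp_all
  have "nbits d + nbits y + 1 \<le> 2 * inst_size I + 1" if "y \<in> set p" for y
    using nbits_demand[OF assms(1)] nbits_demand[of y] that p(1) by auto
  then have "time (member_tm d p) \<le> 1 + length p * (2 * inst_size I + 1)"
    by (rule time_member_tm)
  also have "\<dots> \<le> 1 + q * (2 * inst_size I + 1)"
    using p by (intro add_mono mult_le_mono) auto
  finally have "time (member_tm d p) \<le> 1 + q * (2 * inst_size I + 1)" .
  moreover have "time (on_some_path_tm d S) \<le> 1 + length S * (2 + q * (2 * inst_size I + 1))"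
    by (rule Cons.IH, rule Cons.prems, rule list.set_intros(2))
  ultimately show ?case
    by (simp add: xp)
qed simp

lemma nbits_value:
  assumes "distinct ds" "set ds \<subseteq> set (demands I)"
  shows "nbits (result (value_1R1D_tm I S ds)) \<le> inst_size I"
proof -
  have "nbits (result (value_1R1D_tm I S ds)) \<le> Suc (\<Sum>d\<leftarrow>ds. nbits (reward I d))"
  proof (induction ds)
    case (Cons d ds)
    then show ?case
      using nbits_add[of "reward I d" "result (value_1R1D_tm I S ds)"] by simp
  qed (simp add: nbits_0)
  also have "(\<Sum>d\<leftarrow>ds. nbits (reward I d)) = (\<Sum>d\<in>set ds. nbits (reward I d))"
    using assms(1) by (rule sum_list_distinct_conv_sum_set)
  also have "\<dots> \<le> (\<Sum>d\<in>set (demands I). nbits (reward I d))"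
    using assms(2) by (intro sum_mono2) auto
  also have "\<dots> \<le> (\<Sum>d\<in>set (demands I). nbits d + (\<Sum>r\<in>set (req I d). nbits r)
      + nbits (stime I d) + nbits (dur I d) + nbits (reward I d) + nbits (dloc I d))"
    by (intro sum_mono) simp
  finally show ?thesis by (simp add: inst_size_def)
qed

text \<open>All that the time bounds use about a recorded solution: its size limits the number of
  entries, the path lengths and the index lengths, and the demands on its paths have short
  names.\<close>

definition small_sol :: "nat \<Rightarrow> solution \<Rightarrow> bool" where
  "small_sol q S \<longleftrightarrow> sol_size S \<le> q \<and> (\<forall>(x, p)\<in>set S. set p \<subseteq> set (demands I))"

lemma small_solD:
  assumes "small_sol q S" "((r, s, k), p) \<in> set S"
  shows "set p \<subseteq> set (demands I)" "nbits s + nbits k + (\<Sum>d\<leftarrow>p. nbits d) \<le> q" "length p \<le> q"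
  using assms entry_le_sol_size[OF assms(2)] length_le_sum_list_nbits[of p]
  unfolding small_sol_def by auto

lemma time_value_1R1D_tm:
  assumes "small_sol q S" "distinct ds" "set ds \<subseteq> set (demands I)"
  shows "time (value_1R1D_tm I S ds) \<le> value_bound (inst_size I) q"
proof -
  let ?c = "1 + q * (2 + q * (2 * inst_size I + 1))"
  \<comment> \<open>Beyond the search through \<open>S\<close>, a demand costs at most a table
    access, an addition with two arguments of at most \<open>inst_size I\<close> bits, and a
    return.\<close>
  have "time (value_1R1D_tm I S ds) \<le> 1 + length ds * (?c + 3 * inst_size I + 1)"
    using assms(2,3)
  proof (induction ds)
    case (Cons d ds)
    have d: "d \<in> set (demands I)" using Cons.prems by simp
    have "time (on_some_path_tm d S) \<le> 1 + length S * (2 + q * (2 * inst_size I + 1))"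
      by (rule time_on_some_path_tm) (use d small_solD[OF assms(1)] in blast)+
    also have "\<dots> \<le> ?c"
      using length_le_sol_size[of S] assms(1) unfolding small_sol_def
      by (intro add_mono mult_le_mono) auto
    finally have "time (on_some_path_tm d S) \<le> ?c" .
    moreover have "nbits (result (value_1R1D_tm I S ds)) \<le> inst_size I"
      using Cons.prems by (intro nbits_value) auto
    moreover have "nbits (reward I d) \<le> inst_size I"
      using demand_bits[OF d] by simp
    moreover have "time (value_1R1D_tm I S ds) \<le> 1 + length ds * (?c + 3 * inst_size I + 1)"
      using Cons by simp
    ultimately show ?case
      by simp
  qed simp
  also have "length ds \<le> inst_size I"
    using assms(2,3) by (rule length_demand_list)
  then have "1 + length ds * (?c + 3 * inst_size I + 1) \<le> value_bound (inst_size I) q"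
    unfolding value_bound_def by (intro add_mono mult_le_mono) auto
  finally show ?thesis .
qed

text \<open>The size of the recorded solution is tracked along with the time, because the expansion
  runs on the solution that the loop returns.\<close>

lemma time_loop_tm:
  assumes solver: "\<And>J. is_1R1D J \<Longrightarrow> inst_size J \<le> inst_size I \<Longrightarrow>
      feasible J (result (solver J)) \<and> time (solver J) \<le> q \<and> sol_size (result (solver J)) \<le> q"
    and "set rs \<subseteq> set (rtypes I)" "distinct ds" "set ds \<subseteq> set (demands I)"
    and "nbits best \<le> inst_size I" "small_sol q S"
  shows "time (loop_tm solver I rs ds best S) \<le> 1 + length rs *
      (scan_bound (inst_size I) (inst_size I) + inst_size I + q + value_bound (inst_size I) q
        + 2 * inst_size I + 1) \<and>
    small_sol q (snd (result (loop_tm solver I rs ds best S)))"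
  using assms(2-)
proof (induction rs arbitrary: ds best S)
  case (Cons r rs)
  let ?n = "inst_size I"
  let ?c = "scan_bound ?n ?n + ?n + q + value_bound ?n q + 2 * ?n + 1"
  define Dr where "Dr = filter (\<lambda>d. r \<in> set (req I d)) ds"
  define ds' where "ds' = filter (\<lambda>d. r \<notin> set (req I d)) ds"
  define J where "J = restrict_1R1D I r Dr"
  define X where "X = result (solver J)"
  define v where "v = result (value_1R1D_tm I X Dr)"
  define best' where "best' = (if best \<le> v then v else best)"
  define S' where "S' = (if best \<le> v then X else S)"
  have r: "r \<in> set (rtypes I)" and Dr: "set Dr \<subseteq> set (demands I)" "distinct Dr"
    and ds': "set ds' \<subseteq> set (demands I)" "distinct ds'"
    using Cons.prems by (auto simp: Dr_def ds'_def)
  have X: "feasible J X" "time (solver J) \<le> q" "sol_size X \<le> q"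
    using solver[of J] is_1R1D_restrict[OF wf r Dr(2,1)] inst_size_restrict[OF r Dr(1)]
    unfolding X_def J_def by (auto simp: Dr_def)
  have "set p \<subseteq> set (demands I)" if "(x, p) \<in> set X" for x p
    using X(1) that Dr(1) by (cases x) (fastforce simp: feasible_def valid_path_def J_def)
  then have "small_sol q X"
    using X(3) unfolding small_sol_def by blast
  have "length ds \<le> ?n"
    using Cons.prems(2,3) by (rule length_demand_list)
  then have "time (split_demands_tm I r ds) \<le> scan_bound ?n ?n"
    by (rule order_trans[OF time_split_demands_tm[OF r Cons.prems(3)] scan_bound_mono])
  moreover have "time (value_1R1D_tm I X Dr) \<le> value_bound ?n q"
    using \<open>small_sol q X\<close> Dr by (intro time_value_1R1D_tm)
  moreover have v: "nbits v \<le> ?n"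
    unfolding v_def using Dr by (intro nbits_value)
  \<comment> \<open>Both branches make the same recursive call up to the recorded pair, so one
    equation covers them.\<close>
  moreover have rec: "loop_tm solver I (r # rs) ds best S = TM (result (loop_tm solver I rs ds' best' S'))
    (time (split_demands_tm I r ds) + ?n + time (solver J) + time (value_1R1D_tm I X Dr)
      + (nbits best + nbits v) + time (loop_tm solver I rs ds' best' S') + 1)"
    by (simp add: Dr_def[symmetric] ds'_def[symmetric] J_def[symmetric] X_def[symmetric]
        v_def[symmetric] best'_def S'_def bind_tm_def charge_def le_tm_def)
  moreover have prems: "set rs \<subseteq> set (rtypes I)" "nbits best' \<le> ?n" "small_sol q S'"
    using Cons.prems v \<open>small_sol q X\<close> by (auto simp: best'_def S'_def)
  moreover have "time (loop_tm solver I rs ds' best' S') \<le> 1 + length rs * ?c"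
    using Cons.IH prems ds' by blast
  ultimately have "time (loop_tm solver I (r # rs) ds best S) \<le> 1 + length (r # rs) * ?c"
    using X(2) Cons.prems(4) by simp
  moreover have "small_sol q (snd (result (loop_tm solver I (r # rs) ds best S)))"
    unfolding rec using Cons.IH prems ds' by simp
  ultimately show ?case ..
qed simp

lemma time_follow_tm:
  assumes "set p \<subseteq> set (demands I)" "length p \<le> m" "nbits s + nbits k \<le> m"
    "set qs \<subseteq> set (rtypes I)"
  shows "time (follow_tm I (r, s, k) p qs) \<le>
      1 + length qs * (scan_bound (inst_size I) m + inst_size I + m + 1)"
  using assms(4)
proof (induction qs)
  case (Cons q qs)
  have "time (path_for_type_tm I q p) \<le> scan_bound (inst_size I) m"
    by (rule order_trans[OF time_path_for_type_tm scan_bound_mono[OF assms(2)]])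
      (use Cons.prems assms(1) in auto)
  then show ?case
    using Cons nbits_type[of q] assms(3) by simp
qed simp

text \<open>Each type receives at most one copy of the entry, with a new type name and a path that
  is no longer than the original.\<close>

lemma sol_size_follow:
  assumes "nbits s + nbits k + (\<Sum>d\<leftarrow>p. nbits d) \<le> m" "set qs \<subseteq> set (rtypes I)"
  shows "sol_size (result (follow_tm I (r, s, k) p qs)) \<le> length qs * (inst_size I + m)"
  using assms(2)
proof (induction qs)
  case (Cons q qs)
  have "(\<Sum>d\<leftarrow>filter (\<lambda>d. q \<in> set (req I d)) p. nbits d) \<le> (\<Sum>d\<leftarrow>p. nbits d)"
    by (induction p) auto
  then show ?case
    using Cons nbits_type[of q] assms(1) by (simp add: sol_size_Cons)
qed simp

lemma time_expand_tm:
  assumes "small_sol q S"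
  shows "time (expand_tm I S) \<le> expand_bound (inst_size I) q"
proof -
  let ?n = "inst_size I"
  let ?c = "(1 + ?n * (scan_bound ?n q + ?n + q + 1)) + (1 + ?n + ?n * (?n + q))"
  \<comment> \<open>The induction runs over lists of entries of \<open>S\<close>, so that the bounds
    from \<open>small_sol q S\<close> remain available throughout.\<close>
  have "time (expand_tm I T) \<le> 1 + length T * ?c" if "set T \<subseteq> set S" for T
    using that
  proof (induction T)
    case (Cons xp T)
    obtain r s k p where xp: "xp = ((r, s, k), p)" by (metis prod.exhaust)
    then have p: "((r, s, k), p) \<in> set S" using Cons.prems by simp
    note small = small_solD[OF assms p]
    let ?F = "follow_tm I (r, s, k) p (rtypes I)"
    have "time ?F \<le> 1 + length (rtypes I) * (scan_bound ?n q + ?n + q + 1)"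
      using small by (intro time_follow_tm) auto
    also have "\<dots> \<le> 1 + ?n * (scan_bound ?n q + ?n + q + 1)"
      using length_rtypes by (intro add_mono mult_le_mono) auto
    finally have F: "time ?F \<le> 1 + ?n * (scan_bound ?n q + ?n + q + 1)" .
    have "sol_size (result ?F) \<le> length (rtypes I) * (?n + q)"
      using small(2) by (intro sol_size_follow) auto
    also have "\<dots> \<le> ?n * (?n + q)"
      using length_rtypes by (intro mult_le_mono) auto
    finally have "sol_size (result ?F) \<le> ?n * (?n + q)" .
    moreover have "length (result ?F) \<le> ?n"
      using length_rtypes by (simp add: le_trans[OF length_filter_le])
    moreover have "time (append_tm (result ?F) (result (expand_tm I T)))
        \<le> 1 + length (result ?F) + sol_size (result ?F)"
      by (rule time_append_tm)
    ultimately have "time (append_tm (result ?F) (result (expand_tm I T))) \<le> 1 + ?n + ?n * (?n + q)"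
      by linarith
    moreover have "time (expand_tm I (xp # T)) =
        time ?F + time (expand_tm I T) + time (append_tm (result ?F) (result (expand_tm I T)))"
      by (simp add: xp del: result_follow_tm)
    moreover have "time (expand_tm I T) \<le> 1 + length T * ?c"
      using Cons by simp
    moreover have "1 + length (xp # T) * ?c = ?c + (1 + length T * ?c)"
      by simp
    ultimately show ?case
      using F by linarith
  qed simp
  then have "time (expand_tm I S) \<le> 1 + length S * ?c"
    by blast
  also have "\<dots> \<le> 1 + q * ?c"
    using length_le_sol_size[of S] assms unfolding small_sol_def by (intro add_mono mult_le_mono) auto
  finally show ?thesis unfolding expand_bound_def .
qed

lemma time_algorithm_A:
  assumes solver: "\<And>J. is_1R1D J \<Longrightarrow> inst_size J \<le> inst_size I \<Longrightarrow>
      feasible J (result (solver J)) \<and> time (solver J) \<le> q \<and> sol_size (result (solver J)) \<le> q"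
  shows "time (algorithm_A solver I) \<le> sort_bound (inst_size I) + loop_bound (inst_size I) q
    + expand_bound (inst_size I) q + 1"
proof -
  let ?n = "inst_size I"
  let ?c = "scan_bound ?n ?n + ?n + q + value_bound ?n q + 2 * ?n + 1"
  let ?rs = "sort_key (num_resources I) (rtypes I)"
  let ?L = "loop_tm solver I ?rs (demands I) 0 []"
  have *: "set ?rs \<subseteq> set (rtypes I)" "distinct (demands I)" "set (demands I) \<subseteq> set (demands I)"
    "nbits 0 \<le> ?n" "small_sol q []"
    using wf by (simp_all add: wf_mrmd_def small_sol_def nbits_0 inst_size_def)
  note L = time_loop_tm[OF solver *]
  have "time ?L \<le> 1 + length ?rs * ?c"
    by (rule L[THEN conjunct1])
  also have "\<dots> \<le> loop_bound ?n q"
    unfolding loop_bound_def using length_rtypes by (intro add_mono mult_le_mono) auto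
  finally have "time ?L \<le> loop_bound ?n q" .
  moreover have "time (expand_tm I (snd (result ?L))) \<le> expand_bound ?n q"
    by (rule time_expand_tm[OF L[THEN conjunct2]])
  moreover have "time (algorithm_A solver I) =
      time (sort_types_tm I (rtypes I)) + time ?L + time (expand_tm I (snd (result ?L))) + 1"
    by (simp add: algorithm_A_def case_prod_beta)
  ultimately show ?thesis
    using time_sort_types_tm by linarith
qed

end

text \<open>The solver's polynomial is substituted for \<open>q\<close> in the bounds; closure of
  polynomial boundedness under sums and products settles the composition.\<close>

lemma poly_time_algorithm_A:
  assumes "poly_time_1R1D_solver solver"
  shows "poly_time_on wf_mrmd (algorithm_A solver)"
proof -
  obtain c e where ce: "\<And>J. is_1R1D J \<Longrightarrow> time (solver J) \<le> c * inst_size J ^ e + c"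
    using assms unfolding poly_time_1R1D_solver_def poly_time_on_def by blast
  \<comment> \<open>This is monotone, so its value at \<open>inst_size I\<close> covers the calls on
    all subinstances, and the output sizes too, since writing is charged to the solver.\<close>
  let ?q = "\<lambda>n. c * n ^ e + c"
  show ?thesis
  proof (rule poly_time_onI)
    show "poly_bounded (\<lambda>n. sort_bound n + loop_bound n (?q n) + expand_bound n (?q n) + 1)"
      unfolding sort_bound_def loop_bound_def expand_bound_def scan_bound_def value_bound_def
        num_bound_def member_bound_def
      by (intro poly_bounded_intros)
  next
    fix I
    assume wf: "wf_mrmd I"
    show "time (algorithm_A solver I) \<le> sort_bound (inst_size I) +
        loop_bound (inst_size I) (?q (inst_size I)) + expand_bound (inst_size I) (?q (inst_size I)) + 1"
    proof (rule time_algorithm_A[OF wf])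
      fix J
      assume J: "is_1R1D J" "inst_size J \<le> inst_size I"
      have "time (solver J) \<le> ?q (inst_size J)"
        using ce J(1) by blast
      also have "\<dots> \<le> ?q (inst_size I)"
        using J(2) by (intro add_mono mult_le_mono power_mono) auto
      finally show "feasible J (result (solver J)) \<and> time (solver J) \<le> ?q (inst_size I) \<and>
          sol_size (result (solver J)) \<le> ?q (inst_size I)"
        using assms J(1) unfolding poly_time_1R1D_solver_def by (meson order_trans)
    qed
  qed
qed

theorem theorem8:
  fixes solver :: "mrmd \<Rightarrow> solution tm"
  assumes "poly_time_1R1D_solver solver"
  shows "approximation_algorithm (\<lambda>I. real (card (set (rtypes I))))
           (\<lambda>I. wf_mrmd I \<and> rtypes I \<noteq> [] \<and> triangle_ineq I \<and> same_start I)
           (algorithm_A solver)"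
  unfolding approximation_algorithm_def
proof (intro conjI allI impI)
  fix I
  assume I: "wf_mrmd I \<and> rtypes I \<noteq> [] \<and> triangle_ineq I \<and> same_start I"
  let ?S = "snd (result (algorithm_A solver I))"
  have card: "card (set (rtypes I)) = length (rtypes I)"
    using I by (auto simp: wf_mrmd_def distinct_card)
  then have "card (set (rtypes I)) > 0"
    using I by simp
  then show "real (card (set (rtypes I))) \<ge> 1"
    by linarith
  note solver = assms[unfolded poly_time_1R1D_solver_def, THEN conjunct1, rule_format]
  show "feasible I ?S"
    using I by (intro algorithm_A_guarantee solver) auto
  have "opt I \<le> length (rtypes I) * objective I ?S"
    using I by (intro algorithm_A_guarantee solver) auto
  then have "real (opt I) \<le> real (card (set (rtypes I))) * real (objective I ?S)"
    unfolding card by (metis of_nat_le_iff of_nat_mult)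
  then show "1 / real (card (set (rtypes I))) * real (opt I) \<le> real (objective I ?S)"
    using \<open>card (set (rtypes I)) > 0\<close> by (simp add: field_simps)
next
  show "poly_time_on (\<lambda>I. wf_mrmd I \<and> rtypes I \<noteq> [] \<and> triangle_ineq I \<and> same_start I)
      (algorithm_A solver)"
    using poly_time_algorithm_A[OF assms] unfolding poly_time_on_def by blast
qed

end
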